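(* There exist instances of many $p$-objective combinatorial optimization problems, including the multiobjective versions of shortest path, minimum spanning tree, assignment, minimum $s$-$t$-cut, knapsack, and traveling salesman, that do not admit a polynomial-cardinality one-exact, quasi-$2$-exact $(1+\varepsilon)$-approximation set for any $\varepsilon>0$.
   Context: An instance $(X,f)$ of a $p$-objective optimization problem ($p\ge2$ a constant) consists of a set $X$ of feasible solutions and a vector $f=(f_1,\dots,f_p)$ of objective functions $f_i:X\to\mathbb{Q}_{>0}$. Definitions are stated for minimization of all objectives; they are adapted in the straightforward way if objectives are to be maximized (as for knapsack), i.e., "$f_i(x)\le\alpha_i f_i(x')$" is replaced by "$f_i(x)\ge\frac1{\alpha_i}f_i(x')$". The multiobjective version of each named problem has the feasible set of the usual single-objective problem and $p$ objective functions, each of the usual form (total cost, weight, capacity or profit with respect to its own coefficients). One-exact, quasi-$2$-exact $(1+\varepsilon)$-dominance: $x\preceq_\varepsilon^{1,(2)}x'$ iff there is an index $j\in\{2,\dots,p\}$ (possibly depending on $x,x'$) such that $f_1(x)\le f_1(x')$, $f_j(x)\le f_j(x')$, and $f_i(x)\le(1+\varepsilon)\cdot f_i(x')$ for all other $i$. A one-exact, quasi-$2$-exact $(1+\varepsilon)$-approximation set is a set $P\subseteq X$ such that for every $x'\in X$ there is $x\in P$ with $x\preceq_\varepsilon^{1,(2)}x'$. "Polynomial-cardinality" means that the cardinality is bounded by a polynomial in the encoding size of the instance; as usual, non-existence is understood with respect to families of instances of growing encoding size. *)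

theory Defs
  imports
    Complex_Main
    "HOL-Library.Log_Nat"
    "HOL-Combinatorics.Permutations"
    "HOL-Computational_Algebra.Polynomial"
    "Graph_Theory.Pair_Digraph"
begin

section \<open>Multiobjective problems and approximation sets\<close>

text \<open>
  The \<open>p\<close> objective functions of an instance are \<open>objective Pr I i\<close> for \<open>i \<in> {1..p}\<close>;
  values at other indices are junk and never used.
\<close>

datatype sense = Minimize | Maximize

record ('i, 'x) mo_problem =
  sense :: sense
  instances :: "'i set"
  enc_size :: "'i \<Rightarrow> nat"
  feasible :: "'i \<Rightarrow> 'x set"
  objective :: "'i \<Rightarrow> nat \<Rightarrow> 'x \<Rightarrow> rat"

text \<open>\<open>approx_as_good d \<alpha> a b\<close>: the value \<open>a\<close> is at least as good as \<open>b\<close> up to the factor \<open>\<alpha>\<close>.\<close>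

fun approx_as_good :: "sense \<Rightarrow> real \<Rightarrow> rat \<Rightarrow> rat \<Rightarrow> bool" where
  "approx_as_good Minimize \<alpha> a b \<longleftrightarrow> real_of_rat a \<le> \<alpha> * real_of_rat b"
| "approx_as_good Maximize \<alpha> a b \<longleftrightarrow> real_of_rat a \<ge> 1 / \<alpha> * real_of_rat b"

definition dom_one_exact_quasi_two ::
    "sense \<Rightarrow> nat \<Rightarrow> real \<Rightarrow> (nat \<Rightarrow> 'x \<Rightarrow> rat) \<Rightarrow> 'x \<Rightarrow> 'x \<Rightarrow> bool" where
  "dom_one_exact_quasi_two d p \<epsilon> f x x' \<longleftrightarrow>
     (\<exists>j\<in>{2..p}. approx_as_good d 1 (f 1 x) (f 1 x') \<and> approx_as_good d 1 (f j x) (f j x') \<and>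
        (\<forall>i\<in>{1..p} - {1, j}. approx_as_good d (1 + \<epsilon>) (f i x) (f i x')))"

definition approx_set_one_exact_quasi_two ::
    "sense \<Rightarrow> nat \<Rightarrow> real \<Rightarrow> 'x set \<Rightarrow> (nat \<Rightarrow> 'x \<Rightarrow> rat) \<Rightarrow> 'x set \<Rightarrow> bool" where
  "approx_set_one_exact_quasi_two d p \<epsilon> X f P \<longleftrightarrow>
     P \<subseteq> X \<and> (\<forall>x'\<in>X. \<exists>x\<in>P. dom_one_exact_quasi_two d p \<epsilon> f x x')"

text \<open>
  Instances for which no polynomial-cardinality approximation set exists: one family of
  instances of growing encoding size, independent of \<open>\<epsilon>\<close>, that defeats every polynomial bound
  for every \<open>\<epsilon> > 0\<close>.
\<close>

definition has_instances_without_poly_approx :: "nat \<Rightarrow> ('i, 'x) mo_problem \<Rightarrow> bool" where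
  "has_instances_without_poly_approx p Pr \<longleftrightarrow>
     (\<exists>I :: nat \<Rightarrow> 'i.
        range I \<subseteq> instances Pr \<and> strict_mono (\<lambda>n. enc_size Pr (I n)) \<and>
        (\<forall>\<epsilon>::real. \<epsilon> > 0 \<longrightarrow>
           \<not> (\<exists>q :: real poly. \<forall>n. \<exists>P. finite P \<and>
                approx_set_one_exact_quasi_two (sense Pr) p \<epsilon>
                  (feasible Pr (I n)) (objective Pr (I n)) P \<and>
                real (card P) \<le> poly q (real (enc_size Pr (I n))))))"

definition positive_objectives :: "nat \<Rightarrow> 'x set \<Rightarrow> (nat \<Rightarrow> 'x \<Rightarrow> rat) \<Rightarrow> bool" where
  "positive_objectives p X f \<longleftrightarrow> (\<forall>x\<in>X. \<forall>i\<in>{1..p}. f i x > 0)"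

definition positive_coeffs :: "nat \<Rightarrow> 'a set \<Rightarrow> (nat \<Rightarrow> 'a \<Rightarrow> rat) \<Rightarrow> bool" where
  "positive_coeffs p A c \<longleftrightarrow> (\<forall>a\<in>A. \<forall>i\<in>{1..p}. c i a > 0)"


section \<open>Binary encoding length\<close>

text \<open>\<open>floorlog 2 n\<close> is the number of binary digits of \<open>n\<close> (and 0 for \<open>n = 0\<close>).\<close>

definition nat_bits :: "nat \<Rightarrow> nat" where
  "nat_bits n = 1 + floorlog 2 n"

definition rat_bits :: "rat \<Rightarrow> nat" where
  "rat_bits r = (case quotient_of r of (a, b) \<Rightarrow> nat_bits (nat \<bar>a\<bar>) + nat_bits (nat b))"

definition coeffs_bits :: "nat \<Rightarrow> 'a set \<Rightarrow> (nat \<Rightarrow> 'a \<Rightarrow> rat) \<Rightarrow> nat" where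
  "coeffs_bits p A c = (\<Sum>a\<in>A. \<Sum>i\<in>{1..p}. rat_bits (c i a))"

text \<open>
  A graph is encoded by its vertices, the list of its edges (two vertex names each), and \<open>p\<close>
  coefficients per edge; only the number of vertices matters, not the names they carry.
\<close>

definition graph_bits :: "nat \<Rightarrow> nat set \<Rightarrow> 'e set \<Rightarrow> (nat \<Rightarrow> 'e \<Rightarrow> rat) \<Rightarrow> nat" where
  "graph_bits p V E c = card V + card E * (2 * nat_bits (card V)) + coeffs_bits p E c"


section \<open>Shortest path\<close>

type_synonym st_digraph =
  "nat pair_pre_digraph \<times> nat \<times> nat \<times> (nat \<Rightarrow> nat \<times> nat \<Rightarrow> rat)"

fun st_digraph_bits :: "nat \<Rightarrow> st_digraph \<Rightarrow> nat" where
  "st_digraph_bits p (G, s, t, c) =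
     graph_bits p (pverts G) (parcs G) c + 2 * nat_bits (card (pverts G))"

fun valid_st_digraph :: "nat \<Rightarrow> st_digraph \<Rightarrow> bool" where
  "valid_st_digraph p (G, s, t, c) \<longleftrightarrow>
     pair_digraph G \<and> s \<in> pverts G \<and> t \<in> pverts G \<and> s \<noteq> t \<and> positive_coeffs p (parcs G) c"

fun st_paths :: "st_digraph \<Rightarrow> (nat \<times> nat) list set" where
  "st_paths (G, s, t, c) = {es. pre_digraph.apath (with_proj G) s es t}"

fun path_cost :: "st_digraph \<Rightarrow> nat \<Rightarrow> (nat \<times> nat) list \<Rightarrow> rat" where
  "path_cost (G, s, t, c) i es = sum_list (map (c i) es)"

definition shortest_path :: "nat \<Rightarrow> (st_digraph, (nat \<times> nat) list) mo_problem" where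
  "shortest_path p =
     \<lparr> sense = Minimize,
       instances = {I. valid_st_digraph p I \<and> positive_objectives p (st_paths I) (path_cost I)},
       enc_size = st_digraph_bits p,
       feasible = st_paths,
       objective = path_cost \<rparr>"


section \<open>Minimum s-t-cut\<close>

text \<open>A cut is represented by its source side.\<close>

fun st_cuts :: "st_digraph \<Rightarrow> nat set set" where
  "st_cuts (G, s, t, c) = {S. S \<subseteq> pverts G \<and> s \<in> S \<and> t \<notin> S}"

fun cut_capacity :: "st_digraph \<Rightarrow> nat \<Rightarrow> nat set \<Rightarrow> rat" where
  "cut_capacity (G, s, t, c) i S = (\<Sum>a\<in>{a \<in> parcs G. fst a \<in> S \<and> snd a \<notin> S}. c i a)"

definition min_st_cut :: "nat \<Rightarrow> (st_digraph, nat set) mo_problem" where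
  "min_st_cut p =
     \<lparr> sense = Minimize,
       instances = {I. valid_st_digraph p I \<and> positive_objectives p (st_cuts I) (cut_capacity I)},
       enc_size = st_digraph_bits p,
       feasible = st_cuts,
       objective = cut_capacity \<rparr>"


section \<open>Minimum spanning tree\<close>

text \<open>
  Undirected edges are two-element sets. The constant \<open>spanning_tree\<close> of the Graph-Theory
  library is not suitable here, since its acyclicity only excludes directed cycles.
\<close>

definition complete_edges :: "nat set \<Rightarrow> nat set set" where
  "complete_edges V = {{u, v} |u v. u \<in> V \<and> v \<in> V \<and> u \<noteq> v}"

text \<open>The edge set of the closed walk through \<open>vs\<close>; a cycle if \<open>vs\<close> is distinct of length \<open>\<ge> 3\<close>.\<close>

definition cycle_edges :: "nat list \<Rightarrow> nat set set" where
  "cycle_edges vs = {{vs ! i, vs ! (Suc i mod length vs)} |i. i < length vs}"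

definition ugraph_connected :: "nat set \<Rightarrow> nat set set \<Rightarrow> bool" where
  "ugraph_connected V E \<longleftrightarrow> (\<forall>u\<in>V. \<forall>v\<in>V. (u, v) \<in> {(x, y). {x, y} \<in> E}\<^sup>*)"

definition ugraph_acyclic :: "nat set set \<Rightarrow> bool" where
  "ugraph_acyclic E \<longleftrightarrow> \<not> (\<exists>vs. 3 \<le> length vs \<and> distinct vs \<and> cycle_edges vs \<subseteq> E)"

type_synonym weighted_ugraph = "nat set \<times> nat set set \<times> (nat \<Rightarrow> nat set \<Rightarrow> rat)"

fun spanning_trees :: "weighted_ugraph \<Rightarrow> nat set set set" where
  "spanning_trees (V, E, c) = {T. T \<subseteq> E \<and> ugraph_connected V T \<and> ugraph_acyclic T}"

fun edge_set_cost :: "weighted_ugraph \<Rightarrow> nat \<Rightarrow> nat set set \<Rightarrow> rat" where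
  "edge_set_cost (V, E, c) i T = (\<Sum>e\<in>T. c i e)"

fun valid_weighted_ugraph :: "nat \<Rightarrow> weighted_ugraph \<Rightarrow> bool" where
  "valid_weighted_ugraph p (V, E, c) \<longleftrightarrow>
     finite V \<and> V \<noteq> {} \<and> E \<subseteq> complete_edges V \<and> ugraph_connected V E \<and> positive_coeffs p E c"

fun weighted_ugraph_bits :: "nat \<Rightarrow> weighted_ugraph \<Rightarrow> nat" where
  "weighted_ugraph_bits p (V, E, c) = graph_bits p V E c"

definition min_spanning_tree :: "nat \<Rightarrow> (weighted_ugraph, nat set set) mo_problem" where
  "min_spanning_tree p =
     \<lparr> sense = Minimize,
       instances = {I. valid_weighted_ugraph p I \<and>
                       positive_objectives p (spanning_trees I) (edge_set_cost I)},
       enc_size = weighted_ugraph_bits p,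
       feasible = spanning_trees,
       objective = edge_set_cost \<rparr>"


section \<open>Traveling salesman\<close>

text \<open>The symmetric problem on a complete graph; a tour is the edge set of a Hamiltonian cycle.\<close>

fun tours :: "weighted_ugraph \<Rightarrow> nat set set set" where
  "tours (V, E, c) =
     {cycle_edges vs |vs. 3 \<le> length vs \<and> distinct vs \<and> set vs = V \<and> cycle_edges vs \<subseteq> E}"

fun complete_ugraph :: "weighted_ugraph \<Rightarrow> bool" where
  "complete_ugraph (V, E, c) \<longleftrightarrow> 3 \<le> card V \<and> E = complete_edges V"

definition traveling_salesman :: "nat \<Rightarrow> (weighted_ugraph, nat set set) mo_problem" where
  "traveling_salesman p =
     \<lparr> sense = Minimize,
       instances = {I. valid_weighted_ugraph p I \<and> complete_ugraph I \<and>
                       positive_objectives p (tours I) (edge_set_cost I)},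
       enc_size = weighted_ugraph_bits p,
       feasible = tours,
       objective = edge_set_cost \<rparr>"


section \<open>Assignment\<close>

text \<open>An instance \<open>(n, c)\<close> has agents and tasks \<open>{..<n}\<close>; \<open>c i (a, b)\<close> is the cost of giving \<open>b\<close> to \<open>a\<close>.\<close>

type_synonym assignment_instance = "nat \<times> (nat \<Rightarrow> nat \<times> nat \<Rightarrow> rat)"

fun assignments :: "assignment_instance \<Rightarrow> (nat \<Rightarrow> nat) set" where
  "assignments (n, c) = {\<sigma>. \<sigma> permutes {..<n}}"

fun assignment_cost :: "assignment_instance \<Rightarrow> nat \<Rightarrow> (nat \<Rightarrow> nat) \<Rightarrow> rat" where
  "assignment_cost (n, c) i \<sigma> = (\<Sum>a<n. c i (a, \<sigma> a))"

fun valid_assignment_instance :: "nat \<Rightarrow> assignment_instance \<Rightarrow> bool" where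
  "valid_assignment_instance p (n, c) \<longleftrightarrow> positive_coeffs p ({..<n} \<times> {..<n}) c"

fun assignment_bits :: "nat \<Rightarrow> assignment_instance \<Rightarrow> nat" where
  "assignment_bits p (n, c) = n + coeffs_bits p ({..<n} \<times> {..<n}) c"

definition assignment :: "nat \<Rightarrow> (assignment_instance, nat \<Rightarrow> nat) mo_problem" where
  "assignment p =
     \<lparr> sense = Minimize,
       instances = {I. valid_assignment_instance p I \<and>
                       positive_objectives p (assignments I) (assignment_cost I)},
       enc_size = assignment_bits p,
       feasible = assignments,
       objective = assignment_cost \<rparr>"


section \<open>Knapsack\<close>

text \<open>
  An instance \<open>(n, w, B, c)\<close> has items \<open>{..<n}\<close> with weights \<open>w\<close>, capacity \<open>B\<close> and profits \<open>c\<close>.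
  The empty packing has profit 0, so positivity of the objectives on the usual feasible set is
  unsatisfiable; all item profits are required to be positive instead. In the variant
  \<open>knapsack_nonempty\<close> the empty packing is not feasible, and all objective values are positive.
\<close>

type_synonym knapsack_instance =
  "nat \<times> (nat \<Rightarrow> rat) \<times> rat \<times> (nat \<Rightarrow> nat \<Rightarrow> rat)"

fun packings :: "knapsack_instance \<Rightarrow> nat set set" where
  "packings (n, w, B, c) = {S. S \<subseteq> {..<n} \<and> (\<Sum>a\<in>S. w a) \<le> B}"

fun packing_profit :: "knapsack_instance \<Rightarrow> nat \<Rightarrow> nat set \<Rightarrow> rat" where
  "packing_profit (n, w, B, c) i S = (\<Sum>a\<in>S. c i a)"

fun valid_knapsack_instance :: "nat \<Rightarrow> knapsack_instance \<Rightarrow> bool" where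
  "valid_knapsack_instance p (n, w, B, c) \<longleftrightarrow>
     (\<forall>a<n. w a > 0) \<and> B \<ge> 0 \<and> positive_coeffs p {..<n} c"

fun knapsack_bits :: "nat \<Rightarrow> knapsack_instance \<Rightarrow> nat" where
  "knapsack_bits p (n, w, B, c) =
     n + (\<Sum>a<n. rat_bits (w a)) + rat_bits B + coeffs_bits p {..<n} c"

definition knapsack :: "nat \<Rightarrow> (knapsack_instance, nat set) mo_problem" where
  "knapsack p =
     \<lparr> sense = Maximize,
       instances = {I. valid_knapsack_instance p I},
       enc_size = knapsack_bits p,
       feasible = packings,
       objective = packing_profit \<rparr>"

definition knapsack_nonempty :: "nat \<Rightarrow> (knapsack_instance, nat set) mo_problem" where
  "knapsack_nonempty p = (knapsack p)
     \<lparr> instances := {I. valid_knapsack_instance p I \<and>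
                        positive_objectives p (packings I - {{}}) (packing_profit I)},
       feasible := (\<lambda>I. packings I - {{}}) \<rparr>"

end

theory Submission
  imports
    Defs
    "HOL-Library.Countable_Set"
    "HOL-Library.Nat_Bijection"
    "HOL-Real_Asymp.Real_Asymp"
begin

text \<open>
  Number the elements of the finite ground set \<open>E\<close> by \<open>0, 1, \<dots>\<close> and give the \<open>k\<close>-th element cost
  \<open>2\<^sup>k\<close> in the first objective and \<open>2\<^bsup>|E|\<^esup> - 2\<^sup>k\<close> in all others. The first objective then
  determines a solution, and its sum with any other objective is \<open>2\<^bsup>|E|\<^esup>\<close> times the cardinality of
  the solution. Hence a solution of extremal cardinality (minimal when minimizing, maximal when
  maximizing) is dominated by no other solution, whatever \<open>\<epsilon>\<close> is, since the dominance is exact in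
  the first and some further objective. Each problem has instances with exponentially many solutions
  of extremal cardinality, while the costs have only polynomially many bits.
\<close>

section \<open>Complementary binary costs\<close>

text \<open>\<open>to_nat_on E\<close> numbers a finite \<open>E\<close> bijectively by
  \<open>{..<card E}\<close>. All objectives other than the first coincide, so it does not matter
  that the exact index \<open>j\<close> may vary with the pair of solutions.\<close>

definition binary_cost :: "'a set \<Rightarrow> nat \<Rightarrow> 'a \<Rightarrow> rat" where
  "binary_cost E i e =
     (if i = 1 then 2 ^ to_nat_on E e else 2 ^ card E - 2 ^ to_nat_on E e)"

lemma to_nat_on_less_card:
  "finite E \<Longrightarrow> e \<in> E \<Longrightarrow> to_nat_on E e < card E"
  using to_nat_on_finite[of E] by (auto simp: bij_betw_def)

lemma binary_cost_pos:
  assumes "finite E" "e \<in> E"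
  shows "binary_cost E i e > 0"
proof -
  have "(2::rat) ^ to_nat_on E e < 2 ^ card E"
    using to_nat_on_less_card[OF assms] by (intro power_strict_increasing) auto
  then show ?thesis by (simp add: binary_cost_def)
qed

lemma positive_coeffs_binary_cost:
  "finite E \<Longrightarrow> positive_coeffs p E (binary_cost E)"
  by (simp add: positive_coeffs_def binary_cost_pos)

lemma sum_binary_cost_pos:
  assumes "finite E" "A \<subseteq> E" "A \<noteq> {}"
  shows "(\<Sum>e\<in>A. binary_cost E i e) > 0"
  using assms by (intro sum_pos) (auto intro: binary_cost_pos finite_subset)

lemma sum_binary_cost_add:
  assumes "j \<noteq> 1"
  shows "(\<Sum>e\<in>A. binary_cost E 1 e) + (\<Sum>e\<in>A. binary_cost E j e) =
           of_nat (card A) * 2 ^ card E"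
  using assms by (simp add: binary_cost_def sum.distrib[symmetric])

text \<open>The first cost of a set is \<open>set_encode\<close> of its image under the numbering,
  and binary representations are unique.\<close>

lemma sum_binary_cost_inject:
  assumes "finite E" "A \<subseteq> E" "B \<subseteq> E"
    and eq: "(\<Sum>e\<in>A. binary_cost E 1 e) = (\<Sum>e\<in>B. binary_cost E 1 e)"
  shows "A = B"
proof -
  have inj: "inj_on (to_nat_on E) E"
    using to_nat_on_finite[OF assms(1)] by (simp add: bij_betw_def)
  have sum_eq: "(\<Sum>e\<in>C. binary_cost E 1 e) = of_nat (set_encode (to_nat_on E ` C))"
    if "C \<subseteq> E" for C
    using inj_on_subset[OF inj that]
    by (simp add: binary_cost_def set_encode_def sum.reindex)
  have "set_encode (to_nat_on E ` A) = set_encode (to_nat_on E ` B)"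
    using eq unfolding sum_eq[OF assms(2)] sum_eq[OF assms(3)] by simp
  then have "to_nat_on E ` A = to_nat_on E ` B"
    using inj_on_set_encode assms(1-3)
    by (metis finite_imageI finite_subset inj_on_def mem_Collect_eq)
  then show ?thesis
    using inj assms(2,3) by (simp add: inj_on_image_eq_iff)
qed

section \<open>Dominance among solutions of extremal cardinality\<close>

lemma approx_as_good_one:
  "approx_as_good d 1 a b \<longleftrightarrow> (case d of Minimize \<Rightarrow> a \<le> b | Maximize \<Rightarrow> b \<le> a)"
  by (cases d) (simp_all add: of_rat_less_eq)

text \<open>Dominance gives inequalities in objectives \<open>1\<close> and \<open>j\<close>, while
  the cardinalities order the sums of these two objectives the opposite way; hence both inequalities
  are equalities. The map \<open>A\<close> extracts the ground elements of a solution, which may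
  itself be a list, a permutation or a vertex set.\<close>

lemma dominance_imp_eq:
  fixes f :: "nat \<Rightarrow> 'x \<Rightarrow> rat" and A :: "'x \<Rightarrow> 'e set"
  assumes "finite E" "A x \<subseteq> E" "A y \<subseteq> E"
    and f: "\<And>i z. z \<in> {x, y} \<Longrightarrow> 1 \<le> i \<Longrightarrow> f i z = (\<Sum>e\<in>A z. binary_cost E i e)"
    and card: "case d of Minimize \<Rightarrow> card (A y) \<le> card (A x) | Maximize \<Rightarrow> card (A x) \<le> card (A y)"
    and dom: "dom_one_exact_quasi_two d p \<epsilon> f x y"
  shows "A x = A y"
proof -
  from dom obtain j where j: "j \<ge> 2"
    and 1: "approx_as_good d 1 (f 1 x) (f 1 y)" and 2: "approx_as_good d 1 (f j x) (f j y)"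
    by (auto simp: dom_one_exact_quasi_two_def)
  have sum: "f 1 z + f j z = of_nat (card (A z)) * 2 ^ card E" if "z \<in> {x, y}" for z
    using sum_binary_cost_add[of j E "A z"] j that by (simp add: f)
  have card': "case d of Minimize \<Rightarrow> f 1 y + f j y \<le> f 1 x + f j x
                       | Maximize \<Rightarrow> f 1 x + f j x \<le> f 1 y + f j y"
    using card by (cases d) (simp_all add: sum mult_right_mono del: One_nat_def)
  have "f 1 x = f 1 y"
    using 1 2 card' by (cases d) (auto simp: approx_as_good_one)
  then show ?thesis
    using sum_binary_cost_inject[of E "A x" "A y"] assms(1-3) by (simp add: f)
qed

text \<open>Each solution \<open>y\<close> of extremal cardinality is dominated only by solutions
  with the same ground elements, so \<open>P\<close> must meet every fibre of \<open>A\<close> over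
  such a set. Counting images makes the bound independent of whether \<open>A\<close> is
  injective.\<close>

lemma card_approx_set_ge:
  fixes f :: "nat \<Rightarrow> 'x \<Rightarrow> rat" and A :: "'x \<Rightarrow> 'e set"
  assumes "finite E" "\<And>x. x \<in> X \<Longrightarrow> A x \<subseteq> E"
    and f: "\<And>i x. x \<in> X \<Longrightarrow> 1 \<le> i \<Longrightarrow> f i x = (\<Sum>e\<in>A x. binary_cost E i e)"
    and L: "\<And>x. x \<in> X \<Longrightarrow> case d of Minimize \<Rightarrow> L \<le> card (A x) | Maximize \<Rightarrow> card (A x) \<le> L"
    and "finite P" and P: "approx_set_one_exact_quasi_two d p \<epsilon> X f P"
  shows "card (A ` {x \<in> X. card (A x) = L}) \<le> card P"
proof -
  have "A ` {x \<in> X. card (A x) = L} \<subseteq> A ` P"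
  proof clarify
    fix y assume y: "y \<in> X" "L = card (A y)"
    obtain x where x: "x \<in> P" "dom_one_exact_quasi_two d p \<epsilon> f x y"
      using P y(1) by (auto simp: approx_set_one_exact_quasi_two_def)
    have "x \<in> X"
      using P x(1) by (auto simp: approx_set_one_exact_quasi_two_def)
    have "A x = A y"
      using \<open>x \<in> X\<close> y x(2) L[OF \<open>x \<in> X\<close>] assms(1,2)
      by (intro dominance_imp_eq[where E = E and f = f]) (auto simp: f)
    then show "A y \<in> A ` P" using x(1) by auto
  qed
  then have "card (A ` {x \<in> X. card (A x) = L}) \<le> card (A ` P)"
    using \<open>finite P\<close> by (intro card_mono) auto
  also have "\<dots> \<le> card P" using \<open>finite P\<close> by (rule card_image_le)
  finally show ?thesis .
qed

section \<open>Polynomial bounds against exponential growth\<close>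

lemma poly_le_power_degree:
  fixes q :: "real poly"
  obtains D where "0 \<le> D" "\<And>x. 0 \<le> x \<Longrightarrow> poly q x \<le> D * (x + 1) ^ degree q"
proof
  let ?D = "\<Sum>i\<le>degree q. \<bar>coeff q i\<bar>"
  show "0 \<le> ?D" by (simp add: sum_nonneg)
  fix x :: real assume x: "0 \<le> x"
  \<comment> \<open>The base \<open>x + 1\<close> is at least 1, so its powers increase with the
    exponent even where \<open>x < 1\<close>.\<close>
  have "x ^ i \<le> (x + 1) ^ degree q" if "i \<le> degree q" for i
    using x power_mono[of x "x + 1" i] power_increasing[OF that, of "x + 1"] by simp
  then have "(\<Sum>i\<le>degree q. coeff q i * x ^ i) \<le> (\<Sum>i\<le>degree q. \<bar>coeff q i\<bar> * (x + 1) ^ degree q)"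
    using x by (intro sum_mono mult_mono) auto
  then show "poly q x \<le> ?D * (x + 1) ^ degree q"
    by (simp add: poly_altdef sum_distrib_right)
qed

text \<open>Composing \<open>q\<close> with the bound on \<open>s\<close> leaves a polynomial in
  \<open>n + 1\<close> of degree at most \<open>k * degree q\<close>, which \<open>2 ^ n\<close>
  outgrows.\<close>

lemma eventually_poly_less_exponential:
  fixes q :: "real poly" and s :: "nat \<Rightarrow> nat"
  assumes s: "\<And>n. s n \<le> C * Suc n ^ k"
  shows "\<forall>\<^sub>F n in sequentially. poly q (real (s n)) < 2 ^ n"
proof -
  obtain D where D: "0 \<le> D" "\<And>x. 0 \<le> x \<Longrightarrow> poly q x \<le> D * (x + 1) ^ degree q"
    by (rule poly_le_power_degree) blast
  define d where "d = k * degree q"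
  define B where "B = D * (real C + 1) ^ degree q"
  have bound: "poly q (real (s n)) \<le> B * (real n + 1) ^ d" for n
  proof -
    have "real (s n) \<le> real C * (real n + 1) ^ k"
      using of_nat_mono[OF s[of n], where 'a = real] by (simp add: add.commute)
    moreover have "1 \<le> (real n + 1) ^ k" by (simp add: one_le_power)
    ultimately have "real (s n) + 1 \<le> (real C + 1) * (real n + 1) ^ k"
      unfolding distrib_right by linarith
    then have "(real (s n) + 1) ^ degree q \<le> ((real C + 1) * (real n + 1) ^ k) ^ degree q"
      by (intro power_mono) auto
    then have "D * (real (s n) + 1) ^ degree q \<le> B * (real n + 1) ^ d"
      using D(1) by (simp add: B_def d_def power_mult_distrib power_mult mult.assoc mult_left_mono)
    then show ?thesis using D(2)[of "real (s n)"] by simp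
  qed
  have "(\<lambda>n. (real n + 1) ^ d / 2 ^ n) \<longlonglongrightarrow> 0" by real_asymp
  then have "(\<lambda>n. B * ((real n + 1) ^ d / 2 ^ n)) \<longlonglongrightarrow> B * 0"
    by (intro tendsto_intros)
  then have "\<forall>\<^sub>F n in sequentially. B * ((real n + 1) ^ d / 2 ^ n) < 1"
    by (intro order_tendstoD(2)) auto
  then show ?thesis
  proof eventually_elim
    case (elim n)
    then show ?case using bound[of n] by (simp add: field_simps)
  qed
qed

text \<open>Supplies the required growth of encoding sizes. The next index is chosen just above the
  current size, and \<open>n \<le> s n\<close> then forces the next size above it too.\<close>

lemma strict_mono_subsequence_of_unbounded:
  fixes s :: "nat \<Rightarrow> nat"
  assumes "\<And>n. n \<le> s n"
  obtains r :: "nat \<Rightarrow> nat" where "strict_mono r" "strict_mono (\<lambda>n. s (r n))"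
proof -
  define r where "r = rec_nat 0 (\<lambda>_ m. Suc (s m))"
  have Suc: "r (Suc n) = Suc (s (r n))" for n by (simp add: r_def)
  have "strict_mono r" "strict_mono (\<lambda>n. s (r n))"
    unfolding strict_mono_Suc_iff Suc using assms by (auto simp: less_Suc_eq_le Suc_le_lessD)
  then show thesis by (rule that)
qed

text \<open>The common reduction for all problems. Passing to the subsequence \<open>r\<close> is
  harmless: the size bound and the count \<open>2 ^ r n\<close> of extremal images refer to the same
  original index \<open>r n\<close>.\<close>

lemma has_instances_without_poly_approxI:
  fixes Pr :: "('i, 'x) mo_problem" and I :: "nat \<Rightarrow> 'i"
    and E :: "nat \<Rightarrow> 'e set" and A :: "nat \<Rightarrow> 'x \<Rightarrow> 'e set"
  assumes inst: "\<And>n. I n \<in> instances Pr"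
    and size_ge: "\<And>n. n \<le> enc_size Pr (I n)"
    and size_le: "\<And>n. enc_size Pr (I n) \<le> C * Suc n ^ k"
    and fin: "\<And>n. finite (E n)"
    and sub: "\<And>n x. x \<in> feasible Pr (I n) \<Longrightarrow> A n x \<subseteq> E n"
    and obj: "\<And>n i x. x \<in> feasible Pr (I n) \<Longrightarrow> 1 \<le> i \<Longrightarrow>
                objective Pr (I n) i x = (\<Sum>e\<in>A n x. binary_cost (E n) i e)"
    and L: "\<And>n x. x \<in> feasible Pr (I n) \<Longrightarrow>
              case sense Pr of Minimize \<Rightarrow> L n \<le> card (A n x) | Maximize \<Rightarrow> card (A n x) \<le> L n"
    and many: "\<And>n. 2 ^ n \<le> card (A n ` {x \<in> feasible Pr (I n). card (A n x) = L n})"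
  shows "has_instances_without_poly_approx p Pr"
proof -
  obtain r :: "nat \<Rightarrow> nat" where r: "strict_mono r" "strict_mono (\<lambda>n. enc_size Pr (I (r n)))"
    by (rule strict_mono_subsequence_of_unbounded[of "\<lambda>n. enc_size Pr (I n)", OF size_ge])
  have False
    if q: "\<forall>n. \<exists>P. finite P \<and> approx_set_one_exact_quasi_two (sense Pr) p \<epsilon>
             (feasible Pr (I (r n))) (objective Pr (I (r n))) P \<and>
             real (card P) \<le> poly q (real (enc_size Pr (I (r n))))"
    for \<epsilon> and q :: "real poly"
  proof -
    have "\<forall>\<^sub>F n in sequentially. poly q (real (enc_size Pr (I (r n)))) < (2::real) ^ r n"
      using eventually_poly_less_exponential[of "\<lambda>n. enc_size Pr (I n)", OF size_le]
        filterlim_subseq[OF r(1)]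
      by (rule eventually_compose_filterlim)
    then obtain n :: nat where n: "poly q (real (enc_size Pr (I (r n)))) < 2 ^ r n"
      by (auto dest: eventually_happens)
    obtain P where P: "finite P" "approx_set_one_exact_quasi_two (sense Pr) p \<epsilon>
             (feasible Pr (I (r n))) (objective Pr (I (r n))) P"
      "real (card P) \<le> poly q (real (enc_size Pr (I (r n))))"
      using q by blast
    have "card (A (r n) ` {x \<in> feasible Pr (I (r n)). card (A (r n) x) = L (r n)}) \<le> card P"
      by (rule card_approx_set_ge[OF fin sub obj L P(1,2)])
    with many[of "r n"] have "2 ^ r n \<le> card P" by linarith
    then have "(2::real) ^ r n \<le> real (card P)"
      by (metis of_nat_le_iff of_nat_numeral of_nat_power)
    with n P(3) show False by linarith
  qed
  then show ?thesis
    unfolding has_instances_without_poly_approx_def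
    using inst r(2) by (intro exI[of _ "\<lambda>n. I (r n)"]) blast
qed

text \<open>\<open>F\<close> encodes a subset of \<open>{..<n}\<close> as a solution, and the test
  \<open>Q i\<close> decodes membership of \<open>i\<close> from its ground elements, so distinct
  subsets have distinct images.\<close>

lemma card_image_ge_power:
  assumes "finite (A ` Y)" "\<And>S. S \<subseteq> {..<n} \<Longrightarrow> F S \<in> Y"
    and "\<And>S i. S \<subseteq> {..<n} \<Longrightarrow> i < n \<Longrightarrow> i \<in> S \<longleftrightarrow> Q i (A (F S))"
  shows "2 ^ n \<le> card (A ` Y)"
proof -
  have "inj_on (\<lambda>S. A (F S)) (Pow {..<n})"
  proof (intro inj_onI set_eqI)
    fix S T i
    assume *: "S \<in> Pow {..<n}" "T \<in> Pow {..<n}" "A (F S) = A (F T)"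
    show "i \<in> S \<longleftrightarrow> i \<in> T"
      using * assms(3)[of S i] assms(3)[of T i] by (cases "i < n") auto
  qed
  then have "2 ^ n = card ((\<lambda>S. A (F S)) ` Pow {..<n})"
    by (simp add: card_image card_Pow)
  also have "\<dots> \<le> card (A ` Y)"
    using assms(1,2) by (intro card_mono) auto
  finally show ?thesis .
qed

section \<open>Encoding sizes\<close>

lemma nat_bits_le:
  assumes "n \<le> 2 ^ m" shows "nat_bits n \<le> m + 2"
proof -
  have "n < 2 ^ Suc m" using assms by (simp add: le_less_trans)
  then show ?thesis by (simp add: nat_bits_def floorlog_leI)
qed

text \<open>The summand 2 is \<open>nat_bits 1\<close>, the length of the denominator.\<close>

lemma rat_bits_of_nat: "rat_bits (of_nat n) = nat_bits n + 2"
proof -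
  have "quotient_of (of_nat n) = (int n, 1)"
    using quotient_of_int[of "int n"] by (simp add: Rat.of_int_def)
  then show ?thesis by (simp add: rat_bits_def nat_bits_def compute_floorlog[of 2 "Suc 0"] floorlog_eq_zero_iff)
qed

lemma rat_bits_binary_cost:
  assumes "finite E" "e \<in> E"
  shows "rat_bits (binary_cost E i e) \<le> card E + 4"
proof -
  let ?m = "to_nat_on E e"
  have m: "(2::nat) ^ ?m \<le> 2 ^ card E"
    using to_nat_on_less_card[OF assms] by (intro power_increasing) auto
  have "binary_cost E i e = of_nat (if i = 1 then 2 ^ ?m else 2 ^ card E - 2 ^ ?m)"
    using m by (simp add: binary_cost_def of_nat_diff)
  moreover have "nat_bits (if i = 1 then 2 ^ ?m else 2 ^ card E - 2 ^ ?m) \<le> card E + 2"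
    using m by (intro nat_bits_le) auto
  ultimately show ?thesis by (simp add: rat_bits_of_nat del: of_nat_power)
qed

lemma coeffs_bits_binary_cost:
  assumes "finite E"
  shows "coeffs_bits p E (binary_cost E) \<le> card E * (p * (card E + 4))"
proof -
  have "(\<Sum>i\<in>{1..p}. rat_bits (binary_cost E i e)) \<le> p * (card E + 4)" if "e \<in> E" for e
    using sum_bounded_above[of "{1..p}" "\<lambda>i. rat_bits (binary_cost E i e)" "card E + 4"]
      rat_bits_binary_cost[OF assms that] by simp
  then show ?thesis
    using sum_bounded_above[of E "\<lambda>e. \<Sum>i\<in>{1..p}. rat_bits (binary_cost E i e)" "p * (card E + 4)"]
    by (simp add: coeffs_bits_def)
qed

text \<open>At most \<open>w ^ 2\<close> elements carry \<open>p\<close> coefficients each, of at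
  most \<open>w ^ 2 + 4 \<le> 5 * w ^ 2\<close> bits; \<open>w\<close> stands for a bound on the
  number of vertices.\<close>

lemma coeffs_bits_binary_cost_le:
  assumes "finite E" "card E \<le> w ^ 2" "0 < w"
  shows "coeffs_bits p E (binary_cost E) \<le> 5 * p * w ^ 4"
proof -
  have "1 \<le> w ^ 2" using assms(3) by simp
  then have "card E + 4 \<le> 5 * w ^ 2" using assms(2) by linarith
  then have "card E * (p * (card E + 4)) \<le> w ^ 2 * (p * (5 * w ^ 2))"
    using assms(2) by (intro mult_mono) auto
  also have "\<dots> = 5 * p * w ^ 4"
    by (simp add: power2_eq_square power4_eq_xxxx)
  finally show ?thesis
    using coeffs_bits_binary_cost[OF assms(1), of p] by linarith
qed

lemma graph_bits_binary_cost_le: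
  assumes "finite E" "card E \<le> card V ^ 2" "card V \<le> a * Suc n"
  shows "graph_bits p V E (binary_cost E) \<le> 5 * (p + 1) * Suc a ^ 4 * Suc n ^ 4"
proof -
  \<comment> \<open>Using \<open>Suc a\<close> instead of \<open>a\<close> makes
    \<open>card V < w\<close>, which leaves room for the additive constant in
    \<open>nat_bits\<close>.\<close>
  define w where "w = Suc a * Suc n"
  have w: "0 < w" "card V \<le> w" using assms(3) by (auto simp: w_def)
  have "card V \<le> 2 ^ card V" by (simp add: less_imp_le)
  then have "nat_bits (card V) \<le> card V + 2" by (rule nat_bits_le)
  moreover have "Suc (card V) \<le> w" using assms(3) by (simp add: w_def)
  ultimately have nb: "nat_bits (card V) \<le> 2 * w" using w by linarith
  have E: "card E \<le> w ^ 2" using assms(2) power_mono[OF w(2), of 2] by linarith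
  have pow: "w \<le> w ^ 4" "w ^ 3 \<le> w ^ 4"
    using w(1) power_increasing[of 1 4 w] power_increasing[of 3 4 w] by auto
  have "card E * (2 * nat_bits (card V)) \<le> w ^ 2 * (2 * (2 * w))"
    using E nb by (intro mult_mono) auto
  also have "\<dots> = 4 * w ^ 3" by (simp add: power2_eq_square power3_eq_cube)
  finally have "card E * (2 * nat_bits (card V)) \<le> 4 * w ^ 4" using pow(2) by linarith
  then have "graph_bits p V E (binary_cost E) \<le> w ^ 4 + 4 * w ^ 4 + 5 * p * w ^ 4"
    unfolding graph_bits_def
    using coeffs_bits_binary_cost_le[OF assms(1) E w(1), of p] pow(1) w(2) by linarith
  also have "\<dots> = 5 * (p + 1) * w ^ 4" by (simp add: algebra_simps)
  also have "\<dots> = 5 * (p + 1) * Suc a ^ 4 * Suc n ^ 4"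
    unfolding w_def power_mult_distrib by (simp only: mult.assoc)
  finally show ?thesis .
qed

lemma card_Times_le_square:
  assumes "finite V" "E \<subseteq> V \<times> V"
  shows "card E \<le> card V ^ 2"
  using card_mono[of "V \<times> V" E] assms by (simp add: card_cartesian_product power2_eq_square)

section \<open>Spanning trees\<close>

lemma doubleton_in_complete_edges [simp]:
  "{u, v} \<in> complete_edges V \<longleftrightarrow> u \<in> V \<and> v \<in> V \<and> u \<noteq> v"
  by (auto simp: complete_edges_def doubleton_eq_iff)

lemma
  assumes "finite V"
  shows finite_complete_edges: "finite (complete_edges V)"
    and card_complete_edges_le: "card (complete_edges V) \<le> card V ^ 2"
proof -
  have sub: "complete_edges V \<subseteq> (\<lambda>(u, v). {u, v}) ` (V \<times> V)"
    by (auto simp: complete_edges_def)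
  then show "finite (complete_edges V)"
    using assms by (meson finite_SigmaI finite_imageI finite_subset)
  have "card (complete_edges V) \<le> card (V \<times> V)"
    using sub assms by (intro surj_card_le) auto
  then show "card (complete_edges V) \<le> card V ^ 2"
    by (simp add: card_cartesian_product power2_eq_square)
qed

lemma ugraph_connected_complete: "ugraph_connected V (complete_edges V)"
  unfolding ugraph_connected_def
proof (intro ballI)
  fix u v assume "u \<in> V" "v \<in> V"
  then show "(u, v) \<in> {(x, y). {x, y} \<in> complete_edges V}\<^sup>*"
    by (cases "u = v") (auto intro: r_into_rtrancl)
qed

lemma valid_complete_binary_cost:
  assumes "finite V" "V \<noteq> {}"
  shows "valid_weighted_ugraph p (V, complete_edges V, binary_cost (complete_edges V))"
  using assms
  by (simp add: ugraph_connected_complete positive_coeffs_binary_cost finite_complete_edges)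

text \<open>Every vertex other than the root is charged the last edge of a shortest walk from the root.\<close>

lemma ugraph_connected_imp_card_le:
  assumes "finite V" "V \<noteq> {}" "finite T" "ugraph_connected V T"
  shows "card V \<le> Suc (card T)"
proof -
  obtain r where r: "r \<in> V" using assms(2) by auto
  define R where "R = {(x, y). {x, y} \<in> T}"
  define d where "d v = (LEAST m. (r, v) \<in> R ^^ m)" for v
  have "\<exists>u. {v, u} \<in> T \<and> d u < d v" if "v \<in> V - {r}" for v
  proof -
    have "(r, v) \<in> R\<^sup>*" using assms(4) r that by (auto simp: ugraph_connected_def R_def)
    then have dv: "(r, v) \<in> R ^^ d v"
      unfolding d_def by (auto dest: rtrancl_imp_relpow intro: LeastI)
    moreover have "d v \<noteq> 0" using dv that by (intro notI) auto
    then obtain m where m: "d v = Suc m" by (cases "d v") auto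
    ultimately obtain u where u: "(r, u) \<in> R ^^ m" "(u, v) \<in> R" by auto
    have "d u \<le> m" using u(1) unfolding d_def by (rule Least_le)
    then show ?thesis using u(2) m by (auto simp: R_def insert_commute)
  qed
  then obtain par where par: "\<And>v. v \<in> V - {r} \<Longrightarrow> {v, par v} \<in> T \<and> d (par v) < d v"
    by metis
  have "inj_on (\<lambda>v. {v, par v}) (V - {r})"
  proof (rule inj_onI)
    fix v w assume *: "v \<in> V - {r}" "w \<in> V - {r}" "{v, par v} = {w, par w}"
    show "v = w"
    proof (rule ccontr)
      assume "v \<noteq> w"
      \<comment> \<open>Distinct vertices charged the same edge would be each other's parent, so
        \<open>d\<close> would decrease in both directions.\<close>
      with *(3) have "par v = w" "par w = v" by (auto simp: doubleton_eq_iff)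
      with par[OF *(1)] par[OF *(2)] show False by simp
    qed
  qed
  then have "card (V - {r}) \<le> card T"
    using par assms(3) by (intro card_inj_on_le[of "\<lambda>v. {v, par v}"]) auto
  then show ?thesis using r assms(1) by (simp add: card_Diff_singleton)
qed

text \<open>The neighbours are the cyclic predecessor and successor, which differ because the length
  is at least 3. Applied to the largest vertex of a supposed cycle, this yields acyclicity of the
  parent trees.\<close>

lemma cycle_edges_neighbours:
  assumes "3 \<le> length vs" "distinct vs" "x \<in> set vs"
  obtains a b where "a \<in> set vs" "b \<in> set vs" "a \<noteq> b" "a \<noteq> x" "b \<noteq> x"
    "{x, a} \<in> cycle_edges vs" "{x, b} \<in> cycle_edges vs"
proof -
  let ?L = "length vs"
  obtain k where k: "k < ?L" "x = vs ! k" using assms(3) by (auto simp: in_set_conv_nth)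
  define i where "i = Suc k mod ?L"
  define j where "j = (if k = 0 then ?L - 1 else k - 1)"
  have i: "i = (if Suc k = ?L then 0 else Suc k)" using k(1) by (auto simp: i_def)
  have j': "Suc j mod ?L = k" using k(1) assms(1) by (auto simp: j_def)
  have ij: "i < ?L" "j < ?L" "i \<noteq> j" "i \<noteq> k" "j \<noteq> k"
    using k(1) assms(1) by (auto simp: i j_def split: if_splits)
  have "{x, vs ! i} \<in> cycle_edges vs"
    using k unfolding cycle_edges_def i_def by blast
  moreover have "{vs ! j, vs ! (Suc j mod ?L)} \<in> cycle_edges vs"
    using ij(2) unfolding cycle_edges_def by blast
  then have "{x, vs ! j} \<in> cycle_edges vs" using j' k by (simp add: insert_commute)
  ultimately show thesis
    using ij k assms(2) by (intro that[of "vs ! i" "vs ! j"]) (auto simp: nth_eq_iff_index_eq)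
qed

text \<open>A tree rooted at \<open>0\<close>, given by its parent function; requiring
  \<open>par v < v\<close>, as below, makes parent chains end at the root.\<close>

definition parent_tree :: "nat \<Rightarrow> (nat \<Rightarrow> nat) \<Rightarrow> nat set set" where
  "parent_tree n par = (\<lambda>v. {v, par v}) ` {1..n}"

context
  fixes n :: nat and par :: "nat \<Rightarrow> nat"
  assumes par: "\<And>v. v \<in> {1..n} \<Longrightarrow> par v < v"
begin

lemma parent_tree_edge_iff:
  assumes "u < v"
  shows "{v, u} \<in> parent_tree n par \<longleftrightarrow> v \<in> {1..n} \<and> u = par v"
  using assms par by (fastforce simp: parent_tree_def doubleton_eq_iff)

lemma card_parent_tree: "card (parent_tree n par) = n"
proof -
  have "inj_on (\<lambda>v. {v, par v}) {1..n}"
  proof (rule inj_onI)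
    fix v w assume *: "v \<in> {1..n}" "w \<in> {1..n}" "{v, par v} = {w, par w}"
    then show "v = w" using par[OF *(1)] par[OF *(2)] by (auto simp: doubleton_eq_iff)
  qed
  then show ?thesis by (simp add: parent_tree_def card_image)
qed

text \<open>Following parents decreases the vertex until \<open>0\<close>, which gives
  connectedness. The largest vertex of a cycle would have two distinct smaller neighbours, but its
  only smaller neighbour is its parent.\<close>

lemma parent_tree_in_spanning_trees:
  "parent_tree n par \<in> spanning_trees ({..n}, complete_edges {..n}, c)"
proof -
  have sub: "parent_tree n par \<subseteq> complete_edges {..n}"
    using par by (fastforce simp: parent_tree_def)
  let ?R = "{(x, y). {x, y} \<in> parent_tree n par}"
  have root: "(v, 0) \<in> ?R\<^sup>*" if "v \<le> n" for v
    using that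
  proof (induction v rule: less_induct)
    case (less v)
    show ?case
    proof (cases "v = 0")
      case False
      then have v: "v \<in> {1..n}" using less.prems by auto
      then have "(v, par v) \<in> ?R" by (auto simp: parent_tree_def)
      moreover have "(par v, 0) \<in> ?R\<^sup>*" using less par[OF v] by simp
      ultimately show ?thesis by (rule converse_rtrancl_into_rtrancl)
    qed simp
  qed
  have "sym ?R" by (auto simp: sym_def insert_commute)
  then have "sym (?R\<^sup>*)" by (rule sym_rtrancl)
  then have "ugraph_connected {..n} (parent_tree n par)"
    unfolding ugraph_connected_def using root
    by (meson atMost_iff rtrancl_trans symE)
  moreover have "ugraph_acyclic (parent_tree n par)"
    unfolding ugraph_acyclic_def
  proof clarify
    fix vs assume vs: "3 \<le> length vs" "distinct vs" "cycle_edges vs \<subseteq> parent_tree n par"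
    let ?m = "Max (set vs)"
    have "set vs \<noteq> {}" using vs(1) by auto
    then have "?m \<in> set vs" by simp
    then obtain a b where ab: "a \<in> set vs" "b \<in> set vs" "a \<noteq> b" "a \<noteq> ?m" "b \<noteq> ?m"
      "{?m, a} \<in> cycle_edges vs" "{?m, b} \<in> cycle_edges vs"
      using cycle_edges_neighbours[OF vs(1,2)] by metis
    then have "a < ?m" "b < ?m" by (simp_all add: le_neq_trans)
    then have "a = par ?m" "b = par ?m"
      using ab vs(3) parent_tree_edge_iff by auto
    with ab show False by simp
  qed
  ultimately show ?thesis using sub by simp
qed

end

text \<open>In the complete graph on \<open>n + 2\<close> vertices, connectedness forces at least
  \<open>n + 1\<close> edges, and parent trees attain this.\<close>

lemma has_instances_min_spanning_tree:
  "has_instances_without_poly_approx p (min_spanning_tree p)"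
proof -
  define V where "V n = {..Suc n}" for n :: nat
  define E where "E n = complete_edges (V n)" for n
  define I where "I n = (V n, E n, binary_cost (E n))" for n
  have fin: "finite (E n)" for n by (simp add: E_def V_def finite_complete_edges)
  have card_tree: "Suc n \<le> card T" if "T \<in> spanning_trees (I n)" for n T
  proof -
    have "finite T" using that fin[of n] by (auto simp: I_def intro: finite_subset)
    then show ?thesis
      using ugraph_connected_imp_card_le[of "V n" T] that by (simp add: I_def V_def)
  qed
  show ?thesis
  proof (rule has_instances_without_poly_approxI[where I = I and E = E and A = "\<lambda>_ T. T"
        and L = Suc and C = "5 * (p + 1) * 3 ^ 4" and k = 4])
    show "I n \<in> instances (min_spanning_tree p)" for n
    proof -
      have "T \<noteq> {}" if "T \<in> spanning_trees (I n)" for T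
        using card_tree[OF that] by auto
      then have "positive_objectives p (spanning_trees (I n)) (edge_set_cost (I n))"
        using fin[of n] by (auto simp: positive_objectives_def I_def intro!: sum_binary_cost_pos)
      then show ?thesis
        using valid_complete_binary_cost[of "V n" p]
        by (simp add: min_spanning_tree_def I_def E_def V_def)
    qed
    show "n \<le> enc_size (min_spanning_tree p) (I n)" for n
      by (simp add: min_spanning_tree_def I_def graph_bits_def V_def)
    \<comment> \<open>The \<open>n + 2\<close> vertices number at most \<open>2 * Suc n\<close>, so
      the general bound applies with \<open>a = 2\<close> and factor \<open>3 ^ 4\<close>.\<close>
    show "enc_size (min_spanning_tree p) (I n) \<le> 5 * (p + 1) * 3 ^ 4 * Suc n ^ 4" for n
      using graph_bits_binary_cost_le[of "E n" "V n" 2 n p] card_complete_edges_le[of "V n"] fin[of n]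
      by (simp add: min_spanning_tree_def I_def E_def V_def)
    show "2 ^ n \<le> card ((\<lambda>T. T) ` {T \<in> feasible (min_spanning_tree p) (I n). card T = Suc n})" for n
    \<comment> \<open>Vertex \<open>1\<close> hangs from the root \<open>0\<close>; vertex
      \<open>i + 2\<close> hangs from \<open>1\<close> if \<open>i \<in> S\<close> and from
      \<open>0\<close> otherwise.\<close>
    proof (rule card_image_ge_power[where
          F = "\<lambda>S. parent_tree (Suc n) (\<lambda>v. if v \<ge> 2 \<and> v - 2 \<in> S then 1 else 0)"
          and Q = "\<lambda>i T. {i + 2, 1} \<in> T"])
      show "finite ((\<lambda>T. T) ` {T \<in> feasible (min_spanning_tree p) (I n). card T = Suc n})"
        using fin[of n]
        by (auto simp: min_spanning_tree_def I_def intro: finite_subset[of _ "Pow (E n)"])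
    next
      fix S :: "nat set"
      let ?par = "\<lambda>v. if v \<ge> 2 \<and> v - 2 \<in> S then 1 else 0 :: nat"
      have par: "\<And>v. v \<in> {1..Suc n} \<Longrightarrow> ?par v < v" by auto
      show "parent_tree (Suc n) ?par \<in> {T \<in> feasible (min_spanning_tree p) (I n). card T = Suc n}"
        using parent_tree_in_spanning_trees[OF par] card_parent_tree[OF par]
        by (simp add: min_spanning_tree_def I_def E_def V_def)
      show "i \<in> S \<longleftrightarrow> {i + 2, 1} \<in> parent_tree (Suc n) ?par" if "i < n" for i
        using that parent_tree_edge_iff[OF par, where u = 1 and v = "i + 2"] by simp
    qed
  qed (use card_tree in \<open>auto simp: min_spanning_tree_def I_def fin\<close>)
qed

section \<open>Tours\<close>

lemma cycle_edges_conv_image: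
  "cycle_edges vs = (\<lambda>i. {vs ! i, vs ! (Suc i mod length vs)}) ` {..<length vs}"
  by (auto simp: cycle_edges_def)

text \<open>Two positions giving the same edge would each be the cyclic successor of the other,
  which is impossible for length at least 3.\<close>

lemma card_cycle_edges:
  assumes "3 \<le> length vs" "distinct vs"
  shows "card (cycle_edges vs) = length vs"
proof -
  let ?L = "length vs"
  have "inj_on (\<lambda>i. {vs ! i, vs ! (Suc i mod ?L)}) {..<?L}"
  proof (rule inj_onI)
    fix i j
    assume *: "i \<in> {..<?L}" "j \<in> {..<?L}"
      and eq: "{vs ! i, vs ! (Suc i mod ?L)} = {vs ! j, vs ! (Suc j mod ?L)}"
    have "Suc i mod ?L < ?L" "Suc j mod ?L < ?L" using assms(1) by (auto intro: mod_less_divisor)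
    then have "i = j \<or> i = Suc j mod ?L \<and> j = Suc i mod ?L"
      using eq * assms(2) by (auto simp: doubleton_eq_iff nth_eq_iff_index_eq)
    then show "i = j"
      using * assms(1) by (cases "Suc i = ?L"; cases "Suc j = ?L") auto
  qed
  then show ?thesis by (simp add: cycle_edges_conv_image card_image)
qed

lemma cycle_edges_subset_complete_edges:
  assumes "3 \<le> length vs" "distinct vs"
  shows "cycle_edges vs \<subseteq> complete_edges (set vs)"
proof -
  have "{vs ! i, vs ! (Suc i mod length vs)} \<in> complete_edges (set vs)" if i: "i < length vs" for i
  proof -
    have "Suc i mod length vs < length vs" using i by (intro mod_less_divisor) auto
    moreover have "i \<noteq> Suc i mod length vs"
      using i assms(1) by (cases "Suc i = length vs") auto
    ultimately show ?thesis using i assms(2) by (simp add: nth_eq_iff_index_eq)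
  qed
  then show ?thesis by (auto simp: cycle_edges_conv_image)
qed

text \<open>
  The vertices \<open>3i\<close>, \<open>3i + 1\<close>, \<open>3i + 2\<close> form the \<open>i\<close>-th gadget of the tour, whose last two
  vertices are visited in the opposite order iff \<open>i \<in> S\<close>; the edge \<open>{3i, 3i + 1}\<close> reveals this.
\<close>

definition gadget_swap :: "nat set \<Rightarrow> nat \<Rightarrow> nat" where
  "gadget_swap S k = 3 * (k div 3) +
     (if k div 3 \<in> S \<and> k mod 3 = 1 then 2 else if k div 3 \<in> S \<and> k mod 3 = 2 then 1 else k mod 3)"

lemma gadget_swap_div: "gadget_swap S k div 3 = k div 3"
  by (simp add: gadget_swap_def)

lemma gadget_swap_mod:
  "gadget_swap S k mod 3 =
     (if k div 3 \<in> S \<and> k mod 3 = 1 then 2 else if k div 3 \<in> S \<and> k mod 3 = 2 then 1 else k mod 3)"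
  by (simp add: gadget_swap_def)

text \<open>The swap keeps the quotient by 3 and exchanges at most the remainders 1 and 2. Being its
  own inverse, it is injective and turns vertices back into positions on the tour.\<close>

lemma gadget_swap_involution [simp]: "gadget_swap S (gadget_swap S k) = k"
proof -
  have "gadget_swap S (gadget_swap S k) mod 3 = k mod 3"
    unfolding gadget_swap_mod gadget_swap_div by simp
  moreover have "gadget_swap S (gadget_swap S k) div 3 = k div 3"
    by (simp add: gadget_swap_div)
  ultimately show ?thesis by (metis div_mult_mod_eq)
qed

lemma gadget_swap_less:
  assumes "S \<subseteq> {..<n}" "k < 3 * n + 4"
  shows "gadget_swap S k < 3 * n + 4"
proof (cases "k div 3 \<in> S")
  case True
  then have "gadget_swap S k div 3 < n" using assms(1) by (auto simp: gadget_swap_div)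
  then show ?thesis by linarith
qed (use assms(2) in \<open>simp add: gadget_swap_def\<close>)

text \<open>The four vertices after the \<open>n\<close> gadgets stay fixed. They give the tour at
  least 3 vertices when \<open>n = 0\<close> and keep the last gadget from wrapping around to the
  first.\<close>

lemma gadget_swap_list:
  assumes "S \<subseteq> {..<n}"
  defines "vs \<equiv> map (gadget_swap S) [0..<3 * n + 4]"
  shows "distinct vs" "set vs = {..<3 * n + 4}"
    and "i < n \<Longrightarrow> {3 * i, 3 * i + 1} \<in> cycle_edges vs \<longleftrightarrow> i \<notin> S"
proof -
  let ?N = "3 * n + 4" and ?g = "gadget_swap S"
  have "inj ?g" by (metis gadget_swap_involution injI)
  then show "distinct vs" by (simp add: vs_def distinct_map inj_on_subset[OF _ subset_UNIV])
  have "x \<in> ?g ` {..<?N}" if "x < ?N" for x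
    using gadget_swap_less[OF assms(1) that] by (intro image_eqI[of _ _ "?g x"]) auto
  then show "set vs = {..<?N}"
    using gadget_swap_less[OF assms(1)] by (auto simp: vs_def atLeast0LessThan)
  have len: "length vs = ?N" by (simp add: vs_def)
  have nth: "vs ! i = ?g i" if "i < ?N" for i using that by (simp add: vs_def del: upt_Suc)
  have mem: "e \<in> cycle_edges vs \<longleftrightarrow> (\<exists>j<?N. e = {?g j, ?g (Suc j mod ?N)})" for e
    unfolding cycle_edges_conv_image image_iff Bex_def using nth len by (simp cong: conj_cong)
  have divmod: "Suc (3 * i) div 3 = i" "Suc (3 * i) mod 3 = 1" by presburger+
  show "{3 * i, 3 * i + 1} \<in> cycle_edges vs \<longleftrightarrow> i \<notin> S" if i: "i < n"
  proof
    assume "i \<notin> S"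
    then have "?g (3 * i) = 3 * i" "?g (3 * i + 1) = 3 * i + 1"
      by (simp_all add: gadget_swap_def divmod)
    moreover have "Suc (3 * i) mod ?N = 3 * i + 1" using i by simp
    ultimately show "{3 * i, 3 * i + 1} \<in> cycle_edges vs"
      unfolding mem using i by (intro exI[of _ "3 * i"]) simp
  next
    assume "{3 * i, 3 * i + 1} \<in> cycle_edges vs"
    then obtain j where j: "j < ?N" "{3 * i, 3 * i + 1} = {?g j, ?g (Suc j mod ?N)}"
      unfolding mem by auto
    \<comment> \<open>Applying the involution turns the edge into the pair of positions of its ends;
      for \<open>i \<in> S\<close> these are \<open>3 * i\<close> and \<open>3 * i + 2\<close>,
      which are not cyclically adjacent.\<close>
    then have "?g ` {3 * i, 3 * i + 1} = ?g ` {?g j, ?g (Suc j mod ?N)}" by simp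
    then have *: "{?g (3 * i), ?g (3 * i + 1)} = {j, Suc j mod ?N}" by simp
    show "i \<notin> S"
    proof
      assume "i \<in> S"
      then have "?g (3 * i) = 3 * i" "?g (3 * i + 1) = 3 * i + 2"
        by (simp_all add: gadget_swap_def divmod)
      with * consider "j = 3 * i" "Suc j mod ?N = 3 * i + 2" | "j = 3 * i + 2" "Suc j mod ?N = 3 * i"
        by (auto simp: doubleton_eq_iff)
      then show False using i by cases auto
    qed
  qed
qed

text \<open>All tours have \<open>3 * n + 4\<close> edges, so every tour is of extremal cardinality
  and it suffices to exhibit \<open>2 ^ n\<close> of them.\<close>

lemma has_instances_traveling_salesman:
  "has_instances_without_poly_approx p (traveling_salesman p)"
proof -
  define V where "V n = {..<3 * n + 4}" for n :: nat
  define E where "E n = complete_edges (V n)" for n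
  define I where "I n = (V n, E n, binary_cost (E n))" for n
  have fin: "finite (E n)" for n by (simp add: E_def V_def finite_complete_edges)
  have card_V: "card (V n) = 3 * n + 4" for n by (simp add: V_def)
  have card_tour: "card T = 3 * n + 4" if "T \<in> tours (I n)" for n T
    using that card_V[of n] by (auto simp: I_def card_cycle_edges distinct_card dest: sym)
  show ?thesis
  proof (rule has_instances_without_poly_approxI[where I = I and E = E and A = "\<lambda>_ T. T"
        and L = "\<lambda>n. 3 * n + 4" and C = "5 * (p + 1) * 5 ^ 4" and k = 4])
    show "I n \<in> instances (traveling_salesman p)" for n
    proof -
      have "T \<noteq> {}" if "T \<in> tours (I n)" for T
        using card_tour[OF that] by auto
      then have "positive_objectives p (tours (I n)) (edge_set_cost (I n))"
        using fin[of n] by (auto simp: positive_objectives_def I_def intro!: sum_binary_cost_pos)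
      then show ?thesis
        using valid_complete_binary_cost[of "V n" p]
        by (auto simp: traveling_salesman_def I_def E_def V_def lessThan_empty_iff)
    qed
    show "n \<le> enc_size (traveling_salesman p) (I n)" for n
      by (simp add: traveling_salesman_def I_def graph_bits_def V_def)
    show "enc_size (traveling_salesman p) (I n) \<le> 5 * (p + 1) * 5 ^ 4 * Suc n ^ 4" for n
      using graph_bits_binary_cost_le[of "E n" "V n" 4 n p] card_complete_edges_le[of "V n"] fin[of n]
      by (simp add: traveling_salesman_def I_def E_def V_def)
    show "2 ^ n \<le> card ((\<lambda>T. T) ` {T \<in> feasible (traveling_salesman p) (I n). card T = 3 * n + 4})" for n
    proof (rule card_image_ge_power[where
          F = "\<lambda>S. cycle_edges (map (gadget_swap S) [0..<3 * n + 4])"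
          and Q = "\<lambda>i T. {3 * i, 3 * i + 1} \<notin> T"])
      show "finite ((\<lambda>T. T) ` {T \<in> feasible (traveling_salesman p) (I n). card T = 3 * n + 4})"
        using fin[of n]
        by (auto simp: traveling_salesman_def I_def intro: finite_subset[of _ "Pow (E n)"])
    next
      fix S assume S: "S \<subseteq> {..<n}"
      let ?vs = "map (gadget_swap S) [0..<3 * n + 4]"
      note vs = gadget_swap_list[OF S]
      have "cycle_edges ?vs \<subseteq> E n"
        using cycle_edges_subset_complete_edges[OF _ vs(1)] vs(2)
        by (simp add: E_def V_def del: upt_Suc set_map)
      then have "cycle_edges ?vs \<in> tours (I n)"
        using vs(1,2) by (auto simp: I_def V_def simp del: upt_Suc set_map intro!: exI[of _ ?vs])
      then show "cycle_edges ?vs \<in> {T \<in> feasible (traveling_salesman p) (I n). card T = 3 * n + 4}"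
        using card_tour by (simp add: traveling_salesman_def)
      show "i \<in> S \<longleftrightarrow> {3 * i, 3 * i + 1} \<notin> cycle_edges ?vs" if "i < n" for i
        using vs(3)[OF that] by simp
    qed
  qed (use card_tour in \<open>auto simp: traveling_salesman_def I_def fin\<close>)
qed

section \<open>Assignments\<close>

text \<open>The ground elements of a permutation form its graph. Every graph has
  \<open>n + 1\<close> pairs, so all \<open>fact (Suc n)\<close> assignments are extremal.\<close>

lemma has_instances_assignment:
  "has_instances_without_poly_approx p (assignment p)"
proof -
  define E where "E n = {..<Suc n} \<times> {..<Suc n}" for n
  define I where "I n = (Suc n, binary_cost (E n))" for n
  define A where "A n \<sigma> = (\<lambda>a. (a, \<sigma> a)) ` {..<Suc n}" for n and \<sigma> :: "nat \<Rightarrow> nat"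
  have fin: "finite (E n)" for n by (simp add: E_def)
  have inj: "inj_on (\<lambda>a. (a, \<sigma> a)) B" for \<sigma> :: "nat \<Rightarrow> nat" and B by (rule inj_onI) simp
  have card_A: "card (A n \<sigma>) = Suc n" for n \<sigma> by (simp add: A_def card_image inj)
  have sub: "A n \<sigma> \<subseteq> E n" if "\<sigma> permutes {..<Suc n}" for n \<sigma>
    using permutes_in_image[OF that] by (auto simp: A_def E_def)
  have cost: "assignment_cost (I n) i \<sigma> = (\<Sum>e\<in>A n \<sigma>. binary_cost (E n) i e)" for n i \<sigma>
    by (simp add: I_def A_def sum.reindex[OF inj] del: sum.lessThan_Suc)
  show ?thesis
  proof (rule has_instances_without_poly_approxI[where I = I and E = E and A = A
        and L = Suc and C = "5 * p + 1" and k = 4])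
    show "I n \<in> instances (assignment p)" for n
    proof -
      have "A n \<sigma> \<noteq> {}" for \<sigma> by (auto simp: A_def)
      then have "positive_objectives p (assignments (I n)) (assignment_cost (I n))"
        unfolding positive_objectives_def cost
        using fin[of n] sub[of _ n] by (auto simp: I_def intro!: sum_binary_cost_pos)
      then show ?thesis
        using positive_coeffs_binary_cost[OF fin[of n]]
        by (simp add: assignment_def I_def E_def)
    qed
    show "n \<le> enc_size (assignment p) (I n)" for n
      by (simp add: assignment_def I_def)
    show "enc_size (assignment p) (I n) \<le> (5 * p + 1) * Suc n ^ 4" for n
    proof -
      have "card (E n) \<le> Suc n ^ 2" by (simp add: E_def power2_eq_square)
      then have "coeffs_bits p (E n) (binary_cost (E n)) \<le> 5 * p * Suc n ^ 4"
        using fin by (intro coeffs_bits_binary_cost_le) auto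
      moreover have "Suc n \<le> Suc n ^ 4" using power_increasing[of 1 4 "Suc n"] by simp
      moreover have "enc_size (assignment p) (I n) = Suc n + coeffs_bits p (E n) (binary_cost (E n))"
        by (simp add: assignment_def I_def E_def)
      ultimately show ?thesis unfolding distrib_right by linarith
    qed
    show "2 ^ n \<le> card (A n ` {\<sigma> \<in> feasible (assignment p) (I n). card (A n \<sigma>) = Suc n})" for n
    proof -
      \<comment> \<open>The graph over \<open>{..<Suc n}\<close> determines the permutation, which
        is the identity elsewhere.\<close>
      have "inj_on (A n) {\<sigma>. \<sigma> permutes {..<Suc n}}"
      proof (intro inj_onI ext)
        fix \<sigma> \<tau> a
        assume *: "\<sigma> \<in> {\<sigma>. \<sigma> permutes {..<Suc n}}" "\<tau> \<in> {\<sigma>. \<sigma> permutes {..<Suc n}}" "A n \<sigma> = A n \<tau>"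
        show "\<sigma> a = \<tau> a"
        proof (cases "a < Suc n")
          case True
          then have "(a, \<sigma> a) \<in> A n \<tau>" unfolding *(3)[symmetric] by (auto simp: A_def)
          then show ?thesis by (auto simp: A_def)
        next
          case False
          then show ?thesis using * by (simp add: permutes_not_in)
        qed
      qed
      then have "card (A n ` {\<sigma>. \<sigma> permutes {..<Suc n}}) = fact (Suc n)"
        by (simp add: card_image card_permutations)
      moreover have "2 ^ m \<le> (fact (Suc m) :: nat)" for m
      proof (induction m)
        case (Suc m)
        have "2 * 2 ^ m \<le> Suc (Suc m) * fact (Suc m)" using Suc by (intro mult_mono) auto
        then show ?case by (simp add: fact_Suc[of "Suc m"] del: fact_Suc)
      qed simp
      ultimately show ?thesis by (simp add: assignment_def I_def card_A del: fact_Suc)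
    qed
  qed (use sub cost in \<open>auto simp: assignment_def I_def fin card_A\<close>)
qed

section \<open>Cuts\<close>

text \<open>The extra term \<open>2 * (a + 2)\<close> pays for the names of the two
  terminals.\<close>

lemma st_digraph_bits_binary_cost_le:
  assumes "finite (pverts G)" "parcs G \<subseteq> pverts G \<times> pverts G" "card (pverts G) \<le> a * Suc n"
  shows "st_digraph_bits p (G, s, t, binary_cost (parcs G)) \<le>
           (5 * (p + 1) * Suc a ^ 4 + 2 * (a + 2)) * Suc n ^ 4"
proof -
  have "finite (parcs G)" using assms(1,2) by (meson finite_SigmaI finite_subset)
  then have 1: "graph_bits p (pverts G) (parcs G) (binary_cost (parcs G))
      \<le> 5 * (p + 1) * Suc a ^ 4 * Suc n ^ 4"
    using assms by (intro graph_bits_binary_cost_le card_Times_le_square)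
  have "card (pverts G) \<le> 2 ^ card (pverts G)" by (simp add: less_imp_le)
  then have "nat_bits (card (pverts G)) \<le> card (pverts G) + 2" by (rule nat_bits_le)
  also have "\<dots> \<le> (a + 2) * Suc n" using assms(3) by simp
  also have "\<dots> \<le> (a + 2) * Suc n ^ 4"
    using power_increasing[of 1 4 "Suc n"] by (intro mult_left_mono) auto
  finally show ?thesis using 1 
    unfolding st_digraph_bits.simps distrib_right[of "5 * (p + 1) * Suc a ^ 4"] mult.assoc[of 2 "a + 2"]
    by linarith
qed

text \<open>The source \<open>n + 1\<close> and the sink \<open>n + 2\<close> are joined by paths of
  two arcs through each of the inner vertices \<open>{..n}\<close>. The inner vertices choose their
  sides independently, and every cut contains exactly one arc per inner vertex.\<close>

lemma has_instances_min_st_cut: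
  "has_instances_without_poly_approx p (min_st_cut p)"
proof -
  \<comment> \<open>One inner vertex more than the \<open>n\<close> binary choices keeps all
    capacities positive even for \<open>n = 0\<close>.\<close>
  define G :: "nat \<Rightarrow> nat pair_pre_digraph"
    where "G n = \<lparr>pverts = {..<n + 3}, parcs = {(n + 1, v) |v. v \<le> n} \<union> {(v, n + 2) |v. v \<le> n}\<rparr>" for n
  define E where "E n = parcs (G n)" for n
  define I where "I n = (G n, n + 1, n + 2, binary_cost (E n))" for n
  define A where "A n S = {a \<in> E n. fst a \<in> S \<and> snd a \<notin> S}" for n S
  have EV: "E n \<subseteq> pverts (G n) \<times> pverts (G n)" for n by (auto simp: E_def G_def)
  then have fin: "finite (E n)" for n by (rule finite_subset) (simp add: G_def)
  have digraph: "pair_digraph (G n)" for n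
    using fin[of n] by unfold_locales (auto simp: G_def E_def)
  have card_A: "card (A n S) = Suc n" if "S \<in> st_cuts (I n)" for n S
  proof -
    \<comment> \<open>An inner vertex on the source side contributes its arc to the sink, any other
      its arc from the source.\<close>
    have "A n S = (\<lambda>v. if v \<in> S then (v, n + 2) else (n + 1, v)) ` {..n}"
      using that by (auto simp: A_def E_def G_def I_def image_iff)
    moreover have "inj_on (\<lambda>v. if v \<in> S then (v, n + 2) else (n + 1, v)) {..n}"
      by (auto simp: inj_on_def split: if_splits)
    ultimately show ?thesis by (simp only: card_image card_atMost)
  qed
  have sub: "A n S \<subseteq> E n" for n S by (auto simp: A_def)
  have cost: "cut_capacity (I n) i S = (\<Sum>e\<in>A n S. binary_cost (E n) i e)" for n i S
    by (simp add: I_def A_def E_def)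
  show ?thesis
  proof (rule has_instances_without_poly_approxI[where I = I and E = E and A = A
        and L = Suc and C = "5 * (p + 1) * 4 ^ 4 + 2 * (3 + 2)" and k = 4])
    show "I n \<in> instances (min_st_cut p)" for n
    proof -
      have "A n S \<noteq> {}" if "S \<in> st_cuts (I n)" for S using card_A[OF that] by auto
      then have "positive_objectives p (st_cuts (I n)) (cut_capacity (I n))"
        unfolding positive_objectives_def cost
        by (auto intro!: sum_binary_cost_pos[OF fin sub])
      then show ?thesis
        using positive_coeffs_binary_cost[OF fin[of n]] digraph
        by (simp add: min_st_cut_def I_def E_def) (simp add: G_def)
    qed
    show "n \<le> enc_size (min_st_cut p) (I n)" for n
      by (simp add: min_st_cut_def I_def graph_bits_def G_def)
    show "enc_size (min_st_cut p) (I n) \<le> (5 * (p + 1) * 4 ^ 4 + 2 * (3 + 2)) * Suc n ^ 4" for n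
      using st_digraph_bits_binary_cost_le[of "G n" 3 n p "n + 1" "n + 2"] EV[of n]
      by (simp add: min_st_cut_def I_def E_def G_def)
    show "2 ^ n \<le> card (A n ` {S \<in> feasible (min_st_cut p) (I n). card (A n S) = Suc n})" for n
    proof (rule card_image_ge_power[where F = "insert (n + 1)" and Q = "\<lambda>i T. (i, n + 2) \<in> T"])
      show "finite (A n ` {S \<in> feasible (min_st_cut p) (I n). card (A n S) = Suc n})"
        using fin[of n] by (auto simp: A_def intro!: finite_subset[of _ "Pow (E n)"])
    next
      fix S assume S: "S \<subseteq> {..<n}"
      then have "insert (n + 1) S \<in> st_cuts (I n)" by (auto simp: I_def G_def)
      then show "insert (n + 1) S \<in> {S \<in> feasible (min_st_cut p) (I n). card (A n S) = Suc n}"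
        using card_A by (simp add: min_st_cut_def)
      show "i \<in> S \<longleftrightarrow> (i, n + 2) \<in> A n (insert (n + 1) S)" if "i < n" for i
        using that S by (auto simp: A_def E_def G_def)
    qed
  qed (use cost card_A in \<open>auto simp: min_st_cut_def fin A_def\<close>)
qed

section \<open>Packings\<close>

context
  fixes I :: "nat \<Rightarrow> knapsack_instance" and E :: "nat \<Rightarrow> nat set"
  defines "E \<equiv> \<lambda>n. {..<2 * Suc n}"
    and "I \<equiv> \<lambda>n. (2 * Suc n, \<lambda>_. 1, of_nat (Suc n), binary_cost (E n))"
begin

text \<open>Unit weights turn the capacity into a bound on the number of items; the largest packings
  are then half of all \<open>2 * Suc n\<close> items.\<close>

lemma knapsack_instance_packings: "packings (I n) = {S. S \<subseteq> E n \<and> card S \<le> Suc n}"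
  by (auto simp: I_def E_def simp del: of_nat_Suc)

lemma knapsack_instance_valid: "valid_knapsack_instance p (I n)"
  using positive_coeffs_binary_cost[of "E n" p] by (simp add: I_def E_def)

text \<open>The constant 80 is \<open>5 * 2 ^ 4\<close>, from the width \<open>2 * Suc n\<close>; 15
  absorbs the item count, the unit weights of 4 bits each and the capacity.\<close>

lemma knapsack_instance_bits:
  "n \<le> knapsack_bits p (I n)" "knapsack_bits p (I n) \<le> (80 * p + 15) * Suc n ^ 4"
proof -
  let ?N = "Suc n"
  show "n \<le> knapsack_bits p (I n)" by (simp add: I_def)
  have "nat_bits ?N \<le> ?N + 2" by (intro nat_bits_le less_imp_le less_exp)
  then have B: "rat_bits (of_nat ?N) \<le> ?N + 4" unfolding rat_bits_of_nat by simp
  have "rat_bits 1 = 4"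
    using rat_bits_of_nat[of 1] by (simp add: nat_bits_def compute_floorlog[of 2 "Suc 0"] floorlog_eq_zero_iff)
  then have w: "(\<Sum>a<2 * ?N. rat_bits (1 :: rat)) = 8 * ?N" by simp
  have "card (E n) \<le> (2 * ?N) ^ 2" by (simp add: E_def power2_eq_square)
  then have "coeffs_bits p (E n) (binary_cost (E n)) \<le> 5 * p * (2 * ?N) ^ 4"
    by (intro coeffs_bits_binary_cost_le) (auto simp: E_def)
  also have "\<dots> = 80 * p * ?N ^ 4" using power_mult_distrib[of 2 ?N 4] by simp
  finally have c: "coeffs_bits p (E n) (binary_cost (E n)) \<le> 80 * p * ?N ^ 4" .
  have "knapsack_bits p (I n) = 2 * ?N + (\<Sum>a<2 * ?N. rat_bits (1 :: rat)) + rat_bits (of_nat ?N)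
      + coeffs_bits p (E n) (binary_cost (E n))"
    by (simp only: I_def E_def knapsack_bits.simps)
  also have "\<dots> \<le> 2 * ?N + 8 * ?N + (?N + 4) + 80 * p * ?N ^ 4"
    unfolding w using B c by (intro add_mono order_refl)
  also have "\<dots> \<le> 15 * ?N + 80 * p * ?N ^ 4" by simp
  also have "\<dots> \<le> 15 * ?N ^ 4 + 80 * p * ?N ^ 4"
    using power_increasing[of 1 4 ?N] by (intro add_mono mult_le_mono2) auto
  also have "\<dots> = (80 * p + 15) * ?N ^ 4" by (simp only: distrib_right add.commute)
  finally show "knapsack_bits p (I n) \<le> (80 * p + 15) * ?N ^ 4" .
qed

text \<open>Both knapsack variants are covered at once: packings with \<open>Suc n\<close> items are
  non-empty, so they are feasible in either.\<close>

lemma has_instances_knapsack_like: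
  fixes Pr :: "(knapsack_instance, nat set) mo_problem"
  assumes "sense Pr = Maximize" "enc_size Pr = knapsack_bits p" "objective Pr = packing_profit"
    and "\<And>n. I n \<in> instances Pr"
    and feas: "\<And>n. packings (I n) - {{}} \<subseteq> feasible Pr (I n)" "\<And>n. feasible Pr (I n) \<subseteq> packings (I n)"
  shows "has_instances_without_poly_approx p Pr"
proof (rule has_instances_without_poly_approxI[where I = I and E = E and A = "\<lambda>_ S. S"
      and L = Suc and C = "80 * p + 15" and k = 4])
  show "2 ^ n \<le> card ((\<lambda>S. S) ` {S \<in> feasible Pr (I n). card S = Suc n})" for n
  proof -
    have "{S \<in> feasible Pr (I n). card S = Suc n} = {S. S \<subseteq> E n \<and> card S = Suc n}"
      using feas[of n] by (force simp: knapsack_instance_packings)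
    then have card: "card ((\<lambda>S. S) ` {S \<in> feasible Pr (I n). card S = Suc n}) = (2 * Suc n) choose Suc n"
      using n_subsets[of "E n" "Suc n"] by (simp add: E_def)
    \<comment> \<open>This is the bound \<open>(m / k) ^ k \<le> m choose k\<close> with
      \<open>m = 2 * N\<close> and \<open>k = N\<close>.\<close>
    have "2 ^ N \<le> real ((2 * N) choose N)" if "0 < N" for N
      using binomial_ge_n_over_k_pow_k[of N "2 * N", where 'a = real] that by simp
    from this[of "Suc n"] have "2 ^ Suc n \<le> real ((2 * Suc n) choose Suc n)" by blast
    then have "2 ^ Suc n \<le> (2 * Suc n) choose Suc n"
      by (metis of_nat_le_iff of_nat_numeral of_nat_power)
    then show ?thesis unfolding card by simp
  qed
  show "S \<subseteq> E n" if "S \<in> feasible Pr (I n)" for n S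
    using that feas(2)[of n] by (auto simp: knapsack_instance_packings)
  show "case sense Pr of Minimize \<Rightarrow> Suc n \<le> card S | Maximize \<Rightarrow> card S \<le> Suc n"
    if "S \<in> feasible Pr (I n)" for n S
    using that feas(2)[of n] assms(1) by (auto simp: knapsack_instance_packings)
  show "objective Pr (I n) i S = (\<Sum>e\<in>S. binary_cost (E n) i e)" for n i S
    by (simp add: assms(3) I_def)
qed (use assms(2,4) knapsack_instance_bits in \<open>auto simp: E_def\<close>)

lemma has_instances_knapsack:
  "has_instances_without_poly_approx p (knapsack p)"
  "has_instances_without_poly_approx p (knapsack_nonempty p)"
proof -
  show "has_instances_without_poly_approx p (knapsack p)"
    using knapsack_instance_valid by (intro has_instances_knapsack_like) (auto simp: knapsack_def)
  have "positive_objectives p (packings (I n) - {{}}) (packing_profit (I n))" for n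
  proof -
    have "packing_profit (I n) i S > 0" if "S \<in> packings (I n) - {{}}" for i S
      using that sum_binary_cost_pos[of "E n" S i] unfolding knapsack_instance_packings
      by (auto simp: I_def E_def)
    then show ?thesis by (simp add: positive_objectives_def)
  qed
  then show "has_instances_without_poly_approx p (knapsack_nonempty p)"
    using knapsack_instance_valid
    by (intro has_instances_knapsack_like) (auto simp: knapsack_nonempty_def knapsack_def)
qed

end

section \<open>Paths\<close>

text \<open>Each arc raises the level by one, so nothing can recur and the length is the difference
  of the end levels.\<close>

lemma layered_walk:
  fixes lev :: "'a \<Rightarrow> nat"
  assumes "\<And>e. e \<in> set es \<Longrightarrow> lev (snd e) = Suc (lev (fst e))" "pcas u es v"
  shows "lev v = lev u + length es" "distinct es" "distinct (pawalk_verts u es)"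
proof -
  \<comment> \<open>The lower bounds on levels strengthen the induction: the rest of the walk starts
    one level above \<open>u\<close>, hence avoids \<open>u\<close> and the first arc.\<close>
  have "lev v = lev u + length es \<and> distinct es \<and> distinct (pawalk_verts u es) \<and>
      (\<forall>w\<in>set (pawalk_verts u es). lev u \<le> lev w) \<and> (\<forall>e\<in>set es. lev u \<le> lev (fst e))"
    using assms
  proof (induction es arbitrary: u)
    case (Cons e es)
    have e: "fst e = u" "pcas (snd e) es v" "lev (snd e) = Suc (lev u)"
      using Cons.prems by auto
    from Cons.IH[OF Cons.prems(1) e(2)] show ?case using e by fastforce
  qed simp
  then show "lev v = lev u + length es" "distinct es" "distinct (pawalk_verts u es)" by auto
qed

lemma pcas_map_upt:
  "pcas (x a) (map (\<lambda>k. (x k, x (Suc k))) [a..<a + m]) (x (a + m))"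
proof (induction m arbitrary: a)
  case (Suc m)
  then show ?case using Suc[of "Suc a"] by (simp add: upt_conv_Cons del: upt_Suc)
qed simp

text \<open>Layer \<open>k\<close> is \<open>{2 * k, 2 * k + 1}\<close> for
  \<open>k \<le> n + 1\<close>, with all arcs from each layer to the next. Every path from
  \<open>0\<close> to \<open>2 * n + 2\<close> has \<open>n + 1\<close> arcs and chooses freely in
  the \<open>n\<close> layers between.\<close>

lemma has_instances_shortest_path:
  "has_instances_without_poly_approx p (shortest_path p)"
proof -
  define G :: "nat \<Rightarrow> nat pair_pre_digraph"
    where "G n = \<lparr>pverts = {..<2 * n + 4},
      parcs = {(u, v). u < 2 * n + 4 \<and> v < 2 * n + 4 \<and> v div 2 = Suc (u div 2)}\<rparr>" for n
  define E where "E n = parcs (G n)" for n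
  define I where "I n = (G n, 0 :: nat, 2 * n + 2, binary_cost (E n))" for n
  have EV: "E n \<subseteq> pverts (G n) \<times> pverts (G n)" for n by (auto simp: E_def G_def)
  then have fin: "finite (E n)" for n by (rule finite_subset) (simp add: G_def)
  have digraph: "pair_digraph (G n)" for n
    using fin[of n] by unfold_locales (auto simp: G_def E_def)
  have layered: "snd e div 2 = Suc (fst e div 2)" if "e \<in> E n" for n e
    using that by (auto simp: E_def G_def)
  \<comment> \<open>In a layered digraph every walk is a simple path, so the distinctness required
    by \<open>apath\<close> comes for free.\<close>
  have paths: "st_paths (I n) = {es. set es \<subseteq> E n \<and> pcas 0 es (2 * n + 2)}" for n
    using layered_walk(3)[of _ "\<lambda>v. v div 2" 0 "2 * n + 2"] layered
    by (auto simp: I_def E_def pre_digraph.apath_def pre_digraph.awalk_def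
        cas_with_proj_eq awalk_verts_with_proj_eq G_def subset_iff)
  have path: "distinct es" "card (set es) = Suc n" if "es \<in> st_paths (I n)" for n es
  proof -
    have es: "\<And>e. e \<in> set es \<Longrightarrow> snd e div 2 = Suc (fst e div 2)" "pcas 0 es (2 * n + 2)"
      using that layered[of _ n] by (auto simp: paths)
    note walk = layered_walk[of es "\<lambda>v. v div 2", OF es]
    show "distinct es" using walk(2) .
    then show "card (set es) = Suc n" using walk(1) by (simp add: distinct_card)
  qed
  have cost: "path_cost (I n) i es = (\<Sum>e\<in>set es. binary_cost (E n) i e)" if "es \<in> st_paths (I n)" for n i es
    using path(1)[OF that] by (simp add: I_def sum_list_distinct_conv_sum_set)
  show ?thesis
  proof (rule has_instances_without_poly_approxI[where I = I and E = E and A = "\<lambda>_ es. set es"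
        and L = Suc and C = "5 * (p + 1) * 5 ^ 4 + 2 * (4 + 2)" and k = 4])
    show "I n \<in> instances (shortest_path p)" for n
    proof -
      have "path_cost (I n) i es > 0" if "es \<in> st_paths (I n)" for i es
        unfolding cost[OF that] using that path(2)[OF that]
        by (intro sum_binary_cost_pos[OF fin]) (auto simp: paths)
      then have "positive_objectives p (st_paths (I n)) (path_cost (I n))"
        by (simp add: positive_objectives_def)
      then show ?thesis
        using positive_coeffs_binary_cost[OF fin[of n]] digraph
        by (simp add: shortest_path_def I_def E_def) (simp add: G_def)
    qed
    show "n \<le> enc_size (shortest_path p) (I n)" for n
      by (simp add: shortest_path_def I_def graph_bits_def G_def)
    show "enc_size (shortest_path p) (I n) \<le> (5 * (p + 1) * 5 ^ 4 + 2 * (4 + 2)) * Suc n ^ 4" for n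
      using st_digraph_bits_binary_cost_le[of "G n" 4 n p 0 "2 * n + 2"] EV[of n]
      by (simp add: shortest_path_def I_def E_def G_def)
    show "2 ^ n \<le> card (set ` {es \<in> feasible (shortest_path p) (I n). card (set es) = Suc n})" for n
    proof -
      \<comment> \<open>The vertex visited in layer \<open>k\<close>. Membership of \<open>i\<close>
        is encoded in layer \<open>i + 1\<close>; since \<open>S \<subseteq> {..<n}\<close>, layers
        \<open>0\<close> and \<open>n + 1\<close> are left at the two terminals.\<close>
      define x where "x S k = 2 * k + (if 1 \<le> k \<and> k - 1 \<in> S then 1 else 0)" for S and k :: nat
      show ?thesis
      proof (rule card_image_ge_power[where F = "\<lambda>S. map (\<lambda>k. (x S k, x S (Suc k))) [0..<Suc n]"
            and Q = "\<lambda>i T. 2 * Suc i + 1 \<in> fst ` T"])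
        show "finite (set ` {es \<in> feasible (shortest_path p) (I n). card (set es) = Suc n})"
          using fin[of n]
          by (auto simp: shortest_path_def paths intro!: finite_subset[of _ "Pow (E n)"])
      next
        fix S assume S: "S \<subseteq> {..<n}"
        let ?es = "map (\<lambda>k. (x S k, x S (Suc k))) [0..<Suc n]"
        have div: "x S k div 2 = k" for k by (simp add: x_def)
        then have less: "x S k < 2 * n + 4" if "k \<le> Suc n" for k
          using that div[of k] by linarith
        have "set ?es \<subseteq> E n" using less by (auto simp: E_def G_def div simp del: upt_Suc)
        moreover have "x S 0 = 0" "x S (Suc n) = 2 * n + 2" using S by (auto simp: x_def)
        then have "pcas 0 ?es (2 * n + 2)" using pcas_map_upt[of "x S" 0 "Suc n"] by simp
        ultimately have "?es \<in> st_paths (I n)" by (simp add: paths)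
        from this path(2)[OF this] show "?es \<in> {es \<in> feasible (shortest_path p) (I n). card (set es) = Suc n}"
          by (simp add: shortest_path_def del: upt_Suc set_map)
        show "i \<in> S \<longleftrightarrow> 2 * Suc i + 1 \<in> fst ` set ?es" if i: "i < n" for i
        proof -
          have "fst ` set ?es = x S ` {..n}"
            by (auto simp: image_image atLeast0LessThan lessThan_Suc_atMost simp del: upt_Suc)
          moreover have "2 * Suc i + 1 \<in> x S ` {..n} \<longleftrightarrow> x S (Suc i) = 2 * Suc i + 1"
          proof
            assume "2 * Suc i + 1 \<in> x S ` {..n}"
            then obtain k where "2 * Suc i + 1 = x S k" by auto
            moreover from this have "k = Suc i" using div[of k] by simp
            ultimately show "x S (Suc i) = 2 * Suc i + 1" by simp
          next
            assume "x S (Suc i) = 2 * Suc i + 1"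
            then show "2 * Suc i + 1 \<in> x S ` {..n}" using i by (intro image_eqI[of _ _ "Suc i"]) auto
          qed
          moreover have "x S (Suc i) = 2 * Suc i + 1 \<longleftrightarrow> i \<in> S" by (simp add: x_def)
          ultimately show ?thesis by simp
        qed
      qed
    qed
  qed (use cost path paths in \<open>auto simp: shortest_path_def fin\<close>)
qed

theorem theorem3p3:
  fixes p :: nat
  assumes "p \<ge> 2"
  shows "has_instances_without_poly_approx p (shortest_path p) \<and>
         has_instances_without_poly_approx p (min_spanning_tree p) \<and>
         has_instances_without_poly_approx p (assignment p) \<and>
         has_instances_without_poly_approx p (min_st_cut p) \<and>
         has_instances_without_poly_approx p (knapsack p) \<and>
         has_instances_without_poly_approx p (knapsack_nonempty p) \<and>
         has_instances_without_poly_approx p (traveling_salesman p)"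
  by (intro conjI has_instances_shortest_path has_instances_min_spanning_tree
      has_instances_assignment has_instances_min_st_cut has_instances_knapsack
      has_instances_traveling_salesman)

end
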